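(* Let $\mathcal{H}$ be a complex Hilbert space and let $T\in\mathcal{L}^h$ have closed range with positive orthogonal decomposition $T=T_1-T_2$. The MP-proper splitting $T=T^\dagger-V$ of $T$ converges if and only if the proper splittings $T=T_1^\dagger-T_2-W$ and $T=T_1-T_2^\dagger-Z$ both converge. Moreover, in such case, $\max\{\rho((T_1^\dagger-T_2)^\dagger W),\rho((T_1-T_2^\dagger)^\dagger Z)\}=\rho(TV)$.
   Context: $\mathcal{L}(\mathcal{H})$ is the algebra of bounded linear operators on $\mathcal{H}$; $\mathcal{L}^h$ and $\mathcal{L}^+$ are the sets of selfadjoint and positive (semidefinite) operators in it; $\mathcal{R}(\cdot)$, $\mathcal{N}(\cdot)$ denote range and nullspace; $\rho(\cdot)$ is the spectral radius; $A^\dagger$ is the Moore-Penrose inverse of a closed range operator $A$. A proper splitting of $T$ is a decomposition $T=U-V$ with $U,V\in\mathcal{L}(\mathcal{H})$, $\mathcal{R}(U)=\mathcal{R}(T)$, $\mathcal{N}(U)=\mathcal{N}(T)$; it converges if $\rho(U^\dagger V)<1$. Here $V=T^\dagger-T$, $W=T_1^\dagger-T_2-T$ and $Z=T_1-T_2^\dagger-T$, the corresponding operators $U$ being $T^\dagger$, $T_1^\dagger-T_2$ and $T_1-T_2^\dagger$. The positive orthogonal decomposition of $T\in\mathcal{L}^h$ is the unique decomposition $T=T_1-T_2$ with $T_1,T_2\in\mathcal{L}^+$ and $\overline{\mathcal{R}(T_1)}\oplus\overline{\mathcal{R}(T_2)}=\overline{\mathcal{R}(T)}$ (orthogonal sum);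 explicitly $T_1=\frac{|T|+T}{2}$, $T_2=\frac{|T|-T}{2}$. If $\mathcal{R}(T)$ is closed then so are $\mathcal{R}(T_1)$ and $\mathcal{R}(T_2)$. *)

theory Defs
  imports "HOL-Analysis.Analysis"
begin

section \<open>Complex Hilbert spaces\<close>

text \<open>The real inner product of the library is kept as the real part of the complex one, so that
  norm, metric, topology and completeness are those of the library. Definiteness and
  \<open>norm x = sqrt (Re (cinner x x))\<close> are inherited from \<^class>\<open>real_inner\<close>.
  The inner product is linear in the first argument.\<close>

class complex_inner = real_inner +
  fixes scaleC :: "complex \<Rightarrow> 'a \<Rightarrow> 'a" (infixr "*\<^sub>C" 75)
    and cinner :: "'a \<Rightarrow> 'a \<Rightarrow> complex"
  assumes scaleC_add_right: "c *\<^sub>C (x + y) = c *\<^sub>C x + c *\<^sub>C y"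
    and scaleC_add_left: "(c + d) *\<^sub>C x = c *\<^sub>C x + d *\<^sub>C x"
    and scaleC_scaleC: "c *\<^sub>C d *\<^sub>C x = (c * d) *\<^sub>C x"
    and scaleR_scaleC: "r *\<^sub>R x = of_real r *\<^sub>C x"
    and cinner_commute: "cinner x y = cnj (cinner y x)"
    and cinner_add_left: "cinner (x + y) z = cinner x z + cinner y z"
    and cinner_scaleC_left: "cinner (c *\<^sub>C x) y = c * cinner x y"
    and Re_cinner: "Re (cinner x y) = inner x y"

class chilbert_space = complex_inner + complete_space

instantiation complex :: chilbert_space
begin

definition scaleC_complex :: "complex \<Rightarrow> complex \<Rightarrow> complex"
  where "scaleC_complex c x = c * x"

definition cinner_complex :: "complex \<Rightarrow> complex \<Rightarrow> complex"
  where "cinner_complex x y = x * cnj y"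

instance
  by standard
    (auto simp: scaleC_complex_def cinner_complex_def inner_complex_def algebra_simps
      complex_eq_iff)

end

section \<open>Bounded linear operators\<close>

text \<open>Operators are plain functions; \<open>A - B\<close> is the pointwise difference and
  \<open>A \<circ> B\<close> the product of operators.\<close>

definition bounded_clinear :: "('a::chilbert_space \<Rightarrow> 'a) \<Rightarrow> bool"
  where "bounded_clinear A \<longleftrightarrow> bounded_linear A \<and> (\<forall>c x. A (c *\<^sub>C x) = c *\<^sub>C A x)"

definition selfadjoint :: "('a::chilbert_space \<Rightarrow> 'a) \<Rightarrow> bool"
  where "selfadjoint A \<longleftrightarrow> bounded_clinear A \<and> (\<forall>x y. cinner (A x) y = cinner x (A y))"

definition positive_op :: "('a::chilbert_space \<Rightarrow> 'a) \<Rightarrow> bool"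
  where "positive_op A \<longleftrightarrow> selfadjoint A \<and> (\<forall>x. 0 \<le> Re (cinner (A x) x))"

definition nullspace :: "('a::chilbert_space \<Rightarrow> 'a) \<Rightarrow> 'a set"
  where "nullspace A = {x. A x = 0}"

definition spectrum :: "('a::chilbert_space \<Rightarrow> 'a) \<Rightarrow> complex set"
  where "spectrum A = {c. \<not> (\<exists>B. bounded_clinear B \<and>
    B \<circ> (A - (\<lambda>x. c *\<^sub>C x)) = id \<and> (A - (\<lambda>x. c *\<^sub>C x)) \<circ> B = id)}"

text \<open>Inserting 0 only matters on the zero space, where the spectrum is empty and the spectral
  radius is 0.\<close>

definition spectral_radius :: "('a::chilbert_space \<Rightarrow> 'a) \<Rightarrow> real"
  where "spectral_radius A = Sup (insert 0 (cmod ` spectrum A))"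

text \<open>The unique bounded solution of the four Penrose equations, which exists exactly when the
  range of \<open>A\<close> is closed; the value for other operators is unspecified.\<close>

definition mp_inverse :: "('a::chilbert_space \<Rightarrow> 'a) \<Rightarrow> 'a \<Rightarrow> 'a"
  where "mp_inverse A = (THE X. bounded_clinear X \<and> A \<circ> X \<circ> A = A \<and> X \<circ> A \<circ> X = X \<and>
    selfadjoint (A \<circ> X) \<and> selfadjoint (X \<circ> A))"

section \<open>Decompositions and splittings\<close>

definition pos_orth_decomposition ::
    "('a::chilbert_space \<Rightarrow> 'a) \<Rightarrow> ('a \<Rightarrow> 'a) \<Rightarrow> ('a \<Rightarrow> 'a) \<Rightarrow> bool"
  where "pos_orth_decomposition T T1 T2 \<longleftrightarrow>
    T = T1 - T2 \<and> positive_op T1 \<and> positive_op T2 \<and>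
    (\<forall>x \<in> closure (range T1). \<forall>y \<in> closure (range T2). cinner x y = 0) \<and>
    {x + y |x y. x \<in> closure (range T1) \<and> y \<in> closure (range T2)} = closure (range T)"

definition proper_splitting ::
    "('a::chilbert_space \<Rightarrow> 'a) \<Rightarrow> ('a \<Rightarrow> 'a) \<Rightarrow> ('a \<Rightarrow> 'a) \<Rightarrow> bool"
  where "proper_splitting T U V \<longleftrightarrow> bounded_clinear U \<and> bounded_clinear V \<and> T = U - V \<and>
    range U = range T \<and> nullspace U = nullspace T"

definition splitting_converges :: "('a::chilbert_space \<Rightarrow> 'a) \<Rightarrow> ('a \<Rightarrow> 'a) \<Rightarrow> bool"
  where "splitting_converges U V \<longleftrightarrow> spectral_radius (mp_inverse U \<circ> V) < 1"

end

theory Submission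
  imports Defs
begin

text \<open>The summands \<open>T1\<close> and \<open>T2\<close> and their Moore-Penrose inverses \<open>X1\<close> and \<open>X2\<close> annihilate each
  other, so \<open>X1 - X2\<close> is the Moore-Penrose inverse of \<open>T\<close>, and \<open>X1 - T2\<close> and \<open>T1 - X2\<close> are
  Moore-Penrose inverses of each other. The iteration operators of the last two splittings are then
  \<open>A = T1 X1 - T1\<^sup>2\<close> and \<open>B = T2 X2 - T2\<^sup>2\<close>, that of the first is \<open>A + B\<close>, and \<open>A B = B A = 0\<close>.
  For such operators \<open>(A - c) (B - c) = - c (A + B - c)\<close>, so away from 0 the spectrum of \<open>A + B\<close> is
  the union of the two spectra and the spectral radius of \<open>A + B\<close> is the larger of the two.\<close>

section \<open>Hilbert space preliminaries\<close>

text \<open>The point \<open>m\<close> is the nearest point of \<open>M\<close> to \<open>x\<close>: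
  a minimizing sequence is Cauchy by the parallelogram law, and minimality along each line in
  \<open>M\<close> through \<open>m\<close> makes the residual orthogonal to
  \<open>M\<close>.\<close>

lemma closed_subspace_orthogonal_split:
  fixes M :: "'a::{real_inner,complete_space} set"
  assumes M: "subspace M" and cl: "closed M"
  obtains m where "m \<in> M" "\<And>y. y \<in> M \<Longrightarrow> inner (x - m) y = 0"
proof -
  define \<delta> where "\<delta> = (INF y\<in>M. (norm (x - y))\<^sup>2)"
  have bdd: "bdd_below ((\<lambda>y. (norm (x - y))\<^sup>2) ` M)"
    by (rule bdd_belowI2[where m = 0]) simp
  have ne: "M \<noteq> {}"
    using subspace_0[OF M] by blast
  have \<delta>_le: "\<delta> \<le> (norm (x - y))\<^sup>2" if "y \<in> M" for y
    unfolding \<delta>_def by (rule cINF_lower[OF bdd that])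
  have "\<exists>y\<in>M. (norm (x - y))\<^sup>2 < \<delta> + 1 / Suc n" for n
    using cINF_less_iff[OF ne bdd, of "\<delta> + 1 / Suc n"] unfolding \<delta>_def by simp
  then obtain u where u: "\<And>n. u n \<in> M" "\<And>n. (norm (x - u n))\<^sup>2 < \<delta> + 1 / Suc n"
    by metis
  have u_dist: "(norm (u i - u j))\<^sup>2 \<le> 2 / Suc i + 2 / Suc j" for i j
  proof -
    have "(1/2) *\<^sub>R (u i + u j) \<in> M"
      using u(1) M by (simp add: subspace_add subspace_scale)
    then have "\<delta> \<le> (norm (x - (1/2) *\<^sub>R (u i + u j)))\<^sup>2"
      by (rule \<delta>_le)
    \<comment> \<open>Parallelogram law for \<open>x - u i\<close> and \<open>x - u j\<close>. The
      midpoint lies in \<open>M\<close>, so the last term cancels the infima and leaves twice each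
      slack \<open>1 / Suc n\<close>.\<close>
    moreover have "(norm (u i - u j))\<^sup>2 = 2 * (norm (x - u i))\<^sup>2 + 2 * (norm (x - u j))\<^sup>2
        - 4 * (norm (x - (1/2) *\<^sub>R (u i + u j)))\<^sup>2"
      unfolding power2_norm_eq_inner by (simp add: algebra_simps inner_commute)
    ultimately show ?thesis
      using u(2)[of i] u(2)[of j] by simp
  qed
  have "Cauchy u"
  proof (rule metric_CauchyI)
    fix e :: real assume "0 < e"
    then obtain N where N: "inverse (real (Suc N)) < e\<^sup>2 / 4"
      using reals_Archimedean[of "e\<^sup>2 / 4"] by auto
    have "dist (u i) (u j) < e" if "N \<le> i" "N \<le> j" for i j
    proof -
      have "1 / real (Suc k) \<le> inverse (real (Suc N))" if "N \<le> k" for k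
        using that by (simp add: field_simps)
      from this[OF that(1)] this[OF that(2)] have "(norm (u i - u j))\<^sup>2 < e\<^sup>2"
        using u_dist[of i j] N by linarith
      then show ?thesis
        using \<open>0 < e\<close> by (simp add: dist_norm power_less_imp_less_base)
    qed
    then show "\<exists>N. \<forall>i\<ge>N. \<forall>j\<ge>N. dist (u i) (u j) < e"
      by blast
  qed
  then obtain m where lim: "u \<longlonglongrightarrow> m"
    using Cauchy_convergent convergent_def by blast
  have m: "m \<in> M"
    using closed_sequentially[OF cl _ lim] u(1) by blast
  have "(norm (x - m))\<^sup>2 \<le> \<delta>"
  proof (rule LIMSEQ_le)
    show "(\<lambda>n. (norm (x - u n))\<^sup>2) \<longlonglongrightarrow> (norm (x - m))\<^sup>2"
      by (intro tendsto_intros lim)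
    show "(\<lambda>n. \<delta> + 1 / Suc n) \<longlonglongrightarrow> \<delta>"
      using LIMSEQ_inverse_real_of_nat_add[of \<delta>] by (simp add: inverse_eq_divide)
    show "\<exists>N. \<forall>n\<ge>N. (norm (x - u n))\<^sup>2 \<le> \<delta> + 1 / Suc n"
      using u(2) less_imp_le by blast
  qed
  then have min: "(norm (x - m))\<^sup>2 \<le> (norm (x - y))\<^sup>2" if "y \<in> M" for y
    using \<delta>_le[OF that] by linarith
  have "inner (x - m) y = 0" if y: "y \<in> M" for y
  proof (cases "y = 0")
    case False
    \<comment> \<open>\<open>t *\<^sub>R y\<close> is the projection of \<open>x - m\<close> on the
      line of \<open>y\<close>. Moving \<open>m\<close> by it would lower the squared distance by
      \<open>t * t * inner y y\<close>, which forces \<open>t = 0\<close>.\<close>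
    define t where "t = inner (x - m) y / inner y y"
    have t: "t * inner y y = inner (x - m) y"
      using False by (simp add: t_def)
    have "m + t *\<^sub>R y \<in> M"
      using m y M by (simp add: subspace_add subspace_scale)
    from min[OF this] have "(norm (x - m))\<^sup>2 \<le> (norm ((x - m) - t *\<^sub>R y))\<^sup>2"
      by (simp add: algebra_simps)
    also have "\<dots> = (norm (x - m))\<^sup>2 - 2 * t * inner (x - m) y + t * (t * inner y y)"
      unfolding power2_norm_eq_inner inner_diff_left[of "x - m"] inner_diff_right[of _ "x - m"]
      by (simp add: inner_commute)
    also have "\<dots> = (norm (x - m))\<^sup>2 - t * t * inner y y"
      unfolding t[symmetric] by simp
    finally have "t * t * inner y y \<le> 0"
      by simp
    moreover have "inner y y > 0"
      using False by simp
    ultimately have "t = 0"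
      by (smt (verit) mult_pos_pos mult_eq_0_iff zero_le_square)
    then show ?thesis
      using t by simp
  qed simp
  then show thesis
    using that m by blast
qed

text \<open>By the Baire category theorem the pointwise bounded functionals \<open>inner (S y)\<close> with
  \<open>norm y \<le> 1\<close> are uniformly bounded.\<close>

theorem Hellinger_Toeplitz:
  fixes S :: "'a::{real_inner,complete_space} \<Rightarrow> 'a"
  assumes S: "linear S" and sym: "\<And>x y. inner (S x) y = inner x (S y)"
  shows "bounded_linear S"
proof -
  define E where "E n = {x. \<forall>y. norm y \<le> 1 \<longrightarrow> \<bar>inner (S y) x\<bar> \<le> real n}" for n
  have closed_E: "closed (E n)" for n
  proof -
    have "E n = (\<Inter>y\<in>{y. norm y \<le> 1}. {x. \<bar>inner (S y) x\<bar> \<le> real n})"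
      by (auto simp: E_def)
    then show ?thesis
      by (auto intro!: closed_INT closed_Collect_le continuous_intros)
  qed
  have "x \<in> (\<Union>n. E n)" for x
  proof -
    obtain n where n: "norm (S x) \<le> real n"
      using real_arch_simple by blast
    have "\<bar>inner (S y) x\<bar> \<le> real n" if "norm y \<le> 1" for y
    proof -
      have "\<bar>inner (S y) x\<bar> \<le> norm y * norm (S x)"
        unfolding sym by (rule Cauchy_Schwarz_ineq2)
      also have "\<dots> \<le> 1 * norm (S x)"
        using that by (intro mult_right_mono) auto
      finally show ?thesis using n by simp
    qed
    then show ?thesis
      by (auto simp: E_def)
  qed
  then have "\<Union>(range E) = UNIV"
    by blast
  moreover have "interior (\<Union>(range E)) = {}" if "\<And>n. interior (E n) = {}"
    using Baire_category_alt[of "euclidean :: 'a topology" "range E"] that closed_E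
    by (auto simp: completely_metrizable_space_euclidean)
  ultimately obtain n where "interior (E n) \<noteq> {}"
    by fastforce
  then obtain z where "z \<in> interior (E n)"
    by blast
  then obtain e where e: "0 < e" "cball z e \<subseteq> E n"
    using mem_interior_cball by blast
  have bound: "norm (S y) \<le> 2 * real n / e" if y: "norm y \<le> 1" for y
  proof (cases "S y = 0")
    case False
    \<comment> \<open>\<open>w\<close> points along \<open>S y\<close> and has length
      \<open>e\<close>, so \<open>z\<close> and \<open>z + w\<close> both lie in the ball. Their two
      bounds control \<open>inner (S y) w\<close>, which is \<open>e * norm (S y)\<close>.\<close>
    define w where "w = (e / norm (S y)) *\<^sub>R S y"
    have "norm w = e"
      using e False by (simp add: w_def)
    then have "z + w \<in> E n" "z \<in> E n"
      using e by (auto simp: dist_norm)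
    then have "\<bar>inner (S y) (z + w)\<bar> \<le> real n" "\<bar>inner (S y) z\<bar> \<le> real n"
      using y by (auto simp: E_def)
    then have "inner (S y) w \<le> 2 * real n"
      by (simp add: inner_add_right)
    moreover have "inner (S y) w = e * norm (S y)"
      using False by (simp add: w_def power2_norm_eq_inner[symmetric] power2_eq_square)
    ultimately show ?thesis
      using e by (simp add: field_simps)
  qed (use e in simp)
  have "norm (S x) \<le> norm x * (2 * real n / e)" for x
  proof (cases "x = 0")
    case False
    have "norm (S ((1 / norm x) *\<^sub>R x)) \<le> 2 * real n / e"
      by (rule bound) (use False in simp)
    then show ?thesis
      using False by (simp add: linear_cmul[OF S] field_simps)
  qed (simp add: linear_0[OF S])
  then show ?thesis
    using linear_add[OF S] linear_cmul[OF S] bounded_linear_intro by blast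
qed

section \<open>Arithmetic of the complex inner product\<close>

lemma norm_scaleC: "norm (c *\<^sub>C x) = cmod c * norm (x :: 'a::complex_inner)"
proof -
  have "cinner (c *\<^sub>C x) (c *\<^sub>C x) = c * cnj c * cinner x x"
    using cinner_commute[of x "c *\<^sub>C x"] cinner_commute[of x x]
    by (simp add: cinner_scaleC_left algebra_simps)
  then have "inner (c *\<^sub>C x) (c *\<^sub>C x) = (cmod c)\<^sup>2 * inner x x"
    by (simp add: Re_cinner[symmetric] complex_norm_square[symmetric])
  then have "(norm (c *\<^sub>C x))\<^sup>2 = (cmod c * norm x)\<^sup>2"
    by (simp add: power2_norm_eq_inner power_mult_distrib)
  then show ?thesis
    by simp
qed

lemma scaleC_one [simp]: "1 *\<^sub>C x = (x :: 'a::complex_inner)"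
  using scaleR_scaleC[of 1 x] by simp

lemma scaleC_minus_one: "(- 1) *\<^sub>C x = - (x :: 'a::complex_inner)"
  using scaleR_scaleC[of "- 1" x] by simp

lemma scaleC_zero_right [simp]: "c *\<^sub>C 0 = (0 :: 'a::complex_inner)"
  using scaleC_add_right[of c "0::'a" 0] by simp

lemma scaleC_minus_right: "c *\<^sub>C (- x) = - (c *\<^sub>C (x :: 'a::complex_inner))"
  using scaleC_add_right[of c "- x" x] by (simp add: eq_neg_iff_add_eq_0)

lemma scaleC_diff_right: "c *\<^sub>C (x - y) = c *\<^sub>C x - c *\<^sub>C (y :: 'a::complex_inner)"
  using scaleC_add_right[of c x "- y"] by (simp add: scaleC_minus_right)

lemma cinner_add_right: "cinner x (y + z) = cinner x y + cinner x (z :: 'a::complex_inner)"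
  using cinner_commute[of x "y + z"] cinner_commute[of x y] cinner_commute[of x z]
  by (simp add: cinner_add_left)

lemma cinner_diff_left: "cinner (x - y) z = cinner x z - cinner y (z :: 'a::complex_inner)"
  using cinner_add_left[of "x - y" y z] by simp

lemma cinner_diff_right: "cinner x (y - z) = cinner x y - cinner x (z :: 'a::complex_inner)"
  using cinner_add_right[of x "y - z" z] by simp

lemma cinner_zero [simp]: "cinner 0 x = 0" "cinner x (0 :: 'a::complex_inner) = 0"
  using cinner_add_left[of 0 0 x] cinner_add_right[of x 0 0] by simp_all

lemma cinner_eqI:
  fixes x y :: "'a::complex_inner"
  assumes "\<And>z. cinner x z = cinner y z"
  shows "x = y"
  using assms[of "x - y"] Re_cinner[of "x - y" "x - y"] by (simp add: cinner_diff_left)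

section \<open>Bounded operators and their spectra\<close>

lemma bounded_clinear_linear:
  assumes "bounded_clinear A"
  shows "A (x + y) = A x + A y" "A (x - y) = A x - A y" "A 0 = 0" "A (- x) = - A x"
    "A (c *\<^sub>C x) = c *\<^sub>C A x"
  using assms unfolding bounded_clinear_def
  by (auto simp: linear_simps bounded_linear.linear linear_0)

lemma bounded_clinear_compose:
  "bounded_clinear A \<Longrightarrow> bounded_clinear B \<Longrightarrow> bounded_clinear (A \<circ> B)"
  unfolding bounded_clinear_def comp_def by (auto intro: bounded_linear_compose)

lemma bounded_clinear_diff:
  "bounded_clinear A \<Longrightarrow> bounded_clinear B \<Longrightarrow> bounded_clinear (A - B)"
  unfolding bounded_clinear_def fun_diff_def
  by (auto intro: bounded_linear_sub simp: scaleC_diff_right)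

lemma bounded_clinear_scaleC: "bounded_clinear (\<lambda>x :: 'a::chilbert_space. c *\<^sub>C x)"
  unfolding bounded_clinear_def
proof (intro conjI allI)
  show "bounded_linear (\<lambda>x :: 'a. c *\<^sub>C x)"
    by (rule bounded_linear_intro[where K = "cmod c"])
      (auto simp: scaleC_add_right scaleR_scaleC scaleC_scaleC norm_scaleC mult.commute)
qed (simp add: scaleC_scaleC mult.commute)

section \<open>Invertible operators and commuting factors\<close>

definition invertible_op :: "('a::chilbert_space \<Rightarrow> 'a) \<Rightarrow> bool"
  where "invertible_op F \<longleftrightarrow> (\<exists>B. bounded_clinear B \<and> B \<circ> F = id \<and> F \<circ> B = id)"

lemma spectrum_iff: "c \<in> spectrum A \<longleftrightarrow> \<not> invertible_op (A - (\<lambda>x. c *\<^sub>C x))"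
  by (simp add: spectrum_def invertible_op_def)

lemma invertible_op_compose:
  assumes "invertible_op F" "invertible_op G"
  shows "invertible_op (F \<circ> G)"
proof -
  obtain F' G' where "bounded_clinear F'" "F' \<circ> F = id" "F \<circ> F' = id"
      "bounded_clinear G'" "G' \<circ> G = id" "G \<circ> G' = id"
    using assms unfolding invertible_op_def by blast
  then have "bounded_clinear (G' \<circ> F')" "(G' \<circ> F') \<circ> (F \<circ> G) = id" "(F \<circ> G) \<circ> (G' \<circ> F') = id"
    by (auto intro: bounded_clinear_compose simp: fun_eq_iff)
  then show ?thesis
    unfolding invertible_op_def by blast
qed

text \<open>If \<open>K\<close> inverts the product, then \<open>K \<circ> G\<close> is a left
  inverse of \<open>F\<close> by commutation and \<open>G \<circ> K\<close> is a right inverse by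
  associativity. A left and a right inverse coincide.\<close>

lemma invertible_op_commuting_factor:
  assumes inv: "invertible_op (F \<circ> G)" and comm: "F \<circ> G = G \<circ> F" and G: "bounded_clinear G"
  shows "invertible_op F"
proof -
  obtain K where K: "bounded_clinear K" "K \<circ> (F \<circ> G) = id" "(F \<circ> G) \<circ> K = id"
    using inv unfolding invertible_op_def by blast
  have left: "(K \<circ> G) \<circ> F = id"
    using K(2) comm by (simp add: comp_assoc)
  have right: "F \<circ> (G \<circ> K) = id"
    using K(3) by (simp only: comp_assoc)
  have "K \<circ> G = (K \<circ> G) \<circ> (F \<circ> (G \<circ> K))"
    by (simp only: right comp_id)
  also have "\<dots> = ((K \<circ> G) \<circ> F) \<circ> (G \<circ> K)"
    by (simp only: comp_assoc)
  also have "\<dots> = G \<circ> K"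
    by (simp only: left id_comp)
  finally have "K \<circ> G = G \<circ> K" .
  then show ?thesis
    using left right bounded_clinear_compose[OF G K(1)] unfolding invertible_op_def by metis
qed

lemma invertible_op_scaleC:
  assumes "c \<noteq> 0"
  shows "invertible_op (\<lambda>x :: 'a::chilbert_space. c *\<^sub>C x)"
  unfolding invertible_op_def using assms
  by (intro exI[of _ "\<lambda>x. inverse c *\<^sub>C x"])
    (auto simp: bounded_clinear_scaleC fun_eq_iff scaleC_scaleC)

section \<open>Spectral bounds and sums of annihilating operators\<close>

text \<open>For \<open>onorm A < cmod c\<close> the equation \<open>A x - c *\<^sub>C x = y\<close>
  is the fixed point equation of a contraction with ratio \<open>onorm A / cmod c\<close>. The bound
  makes the supremum in \<open>spectral_radius\<close> a genuine least upper bound.\<close>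

lemma spectrum_norm_le:
  assumes A: "bounded_clinear A" and c: "c \<in> spectrum A"
  shows "cmod c \<le> onorm A"
proof (rule ccontr)
  assume "\<not> cmod c \<le> onorm A"
  then have less: "onorm A < cmod c" by simp
  have bl: "bounded_linear A"
    using A by (simp add: bounded_clinear_def)
  note lin = bounded_clinear_linear[OF A]
  have pos: "0 \<le> onorm A"
    by (rule onorm_pos_le[OF bl])
  have c0: "c \<noteq> 0"
    using less pos by auto
  define R where "R x = A x - c *\<^sub>C x" for x
  have R_eq: "A - (\<lambda>x. c *\<^sub>C x) = R"
    by (auto simp: R_def)
  have R: "bounded_clinear R"
    unfolding R_eq[symmetric] by (intro bounded_clinear_diff A bounded_clinear_scaleC)
  note R_lin = bounded_clinear_linear[OF R]
  have "\<exists>!x. R x = y" for y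
  proof -
    define f where "f x = inverse c *\<^sub>C (A x - y)" for x
    have "\<exists>!x. f x = x"
    proof (rule banach_fix_type)
      show "0 \<le> onorm A / cmod c" "onorm A / cmod c < 1"
        using pos less by (auto intro!: divide_nonneg_nonneg simp: divide_less_eq_1)
      have "dist (f x) (f x') \<le> onorm A / cmod c * dist x x'" for x x'
      proof -
        have "f x - f x' = inverse c *\<^sub>C A (x - x')"
          by (simp add: f_def scaleC_diff_right[symmetric] lin)
        then have "dist (f x) (f x') = norm (A (x - x')) / cmod c"
          by (simp add: dist_norm norm_scaleC norm_inverse divide_inverse mult.commute)
        also have "\<dots> \<le> onorm A * norm (x - x') / cmod c"
          by (intro divide_right_mono onorm bl) simp
        finally show ?thesis by (simp add: dist_norm)
      qed
      then show "\<forall>x x'. dist (f x) (f x') \<le> onorm A / cmod c * dist x x'" by blast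
    qed
    moreover have "f x = x \<longleftrightarrow> R x = y" for x
    proof -
      have "f x = x \<longleftrightarrow> c *\<^sub>C f x = c *\<^sub>C x"
        by (metis c0 left_inverse scaleC_one scaleC_scaleC)
      also have "c *\<^sub>C f x = A x - y"
        using c0 by (simp add: f_def scaleC_scaleC)
      finally show ?thesis
        by (auto simp: R_def algebra_simps)
    qed
    ultimately show ?thesis by simp
  qed
  then obtain B where RB: "\<And>y. R (B y) = y" and uniq: "\<And>x y. R x = y \<Longrightarrow> x = B y"
    by metis
  \<comment> \<open>The reverse triangle inequality bounds \<open>R\<close> from below, which bounds
    the inverse \<open>B\<close>.\<close>
  have R_below: "(cmod c - onorm A) * norm x \<le> norm (R x)" for x
  proof -
    have "cmod c * norm x \<le> norm (A x) + norm (R x)"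
      using norm_triangle_ineq4[of "A x" "R x"] by (simp add: R_def norm_scaleC)
    then show ?thesis
      using onorm[OF bl, of x] by (simp add: algebra_simps)
  qed
  have "bounded_linear B"
  proof (rule bounded_linear_intro)
    show "B (x + y) = B x + B y" for x y
      by (rule uniq[symmetric]) (simp add: R_lin RB)
    show "B (r *\<^sub>R x) = r *\<^sub>R B x" for r x
      by (rule uniq[symmetric]) (simp add: scaleR_scaleC R_lin RB)
    show "norm (B x) \<le> norm x * (1 / (cmod c - onorm A))" for x
      using R_below[of "B x"] less by (simp add: RB field_simps)
  qed
  moreover have "B (d *\<^sub>C x) = d *\<^sub>C B x" for d x
    by (rule uniq[symmetric]) (simp add: R_lin RB)
  ultimately have "bounded_clinear B"
    by (simp add: bounded_clinear_def)
  moreover have "B \<circ> R = id" "R \<circ> B = id"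
    using RB uniq by (auto simp: fun_eq_iff)
  ultimately have "invertible_op R"
    unfolding invertible_op_def by blast
  then show False
    using c by (simp add: spectrum_iff R_eq)
qed

lemma bdd_above_spectrum: "bounded_clinear A \<Longrightarrow> bdd_above (insert 0 (cmod ` spectrum A))"
  by (auto intro!: bdd_aboveI2 spectrum_norm_le)

text \<open>The shifted factors commute, so their product is invertible exactly when both are.
  Dividing by \<open>- c\<close> to recover the shifted sum is where \<open>c \<noteq> 0\<close>
  enters.\<close>

lemma spectrum_add_annihilating:
  assumes A: "bounded_clinear A" and B: "bounded_clinear B"
    and AB: "\<And>x. A (B x) = 0" and BA: "\<And>x. B (A x) = 0" and c: "c \<noteq> 0"
  shows "c \<in> spectrum (\<lambda>x. A x + B x) \<longleftrightarrow> c \<in> spectrum A \<or> c \<in> spectrum B"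
proof -
  define FA FB FS where "FA = A - (\<lambda>x. c *\<^sub>C x)" and "FB = B - (\<lambda>x. c *\<^sub>C x)"
    and "FS = (\<lambda>x. A x + B x) - (\<lambda>x. c *\<^sub>C x)"
  note lin = bounded_clinear_linear[OF A] bounded_clinear_linear[OF B]
  have bc: "bounded_clinear FA" "bounded_clinear FB"
    unfolding FA_def FB_def by (intro bounded_clinear_diff A B bounded_clinear_scaleC)+
  have comm: "FA \<circ> FB = FB \<circ> FA"
    by (simp add: FA_def FB_def fun_eq_iff lin AB BA scaleC_diff_right)
  have prod: "FA \<circ> FB = (\<lambda>x. (- c) *\<^sub>C x) \<circ> FS"
  proof
    fix x
    have neg: "(- c) *\<^sub>C y = - (c *\<^sub>C y)" for y :: 'a
      using scaleC_scaleC[of "- 1" c y] by (simp add: scaleC_minus_one)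
    show "(FA \<circ> FB) x = ((\<lambda>x. (- c) *\<^sub>C x) \<circ> FS) x"
      by (simp add: FA_def FB_def FS_def lin AB neg scaleC_diff_right scaleC_add_right)
  qed
  have FS: "FS = (\<lambda>x. inverse (- c) *\<^sub>C x) \<circ> (FA \<circ> FB)"
    unfolding prod using c by (simp add: fun_eq_iff scaleC_scaleC)
  have "invertible_op FS \<longleftrightarrow> invertible_op (FA \<circ> FB)"
    using c FS prod by (metis invertible_op_compose invertible_op_scaleC neg_equal_0_iff_equal
        nonzero_imp_inverse_nonzero)
  also have "\<dots> \<longleftrightarrow> invertible_op FA \<and> invertible_op FB"
    using bc comm by (metis invertible_op_commuting_factor invertible_op_compose)
  finally show ?thesis
    by (auto simp: spectrum_iff FA_def FB_def FS_def)
qed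

lemma spectral_radius_add_annihilating:
  assumes A: "bounded_clinear A" and B: "bounded_clinear B"
    and AB: "\<And>x. A (B x) = 0" and BA: "\<And>x. B (A x) = 0"
  shows "spectral_radius (\<lambda>x. A x + B x) = max (spectral_radius A) (spectral_radius B)"
proof -
  have "insert 0 (cmod ` spectrum (\<lambda>x. A x + B x)) =
      insert 0 (cmod ` spectrum A) \<union> insert 0 (cmod ` spectrum B)" (is "?S = ?A \<union> ?B")
  proof -
    \<comment> \<open>The inserted 0 belongs to all three sets, so only nonzero moduli have to be
      compared.\<close>
    have "r \<in> ?S \<longleftrightarrow> r \<in> ?A \<union> ?B" if "r \<noteq> 0" for r
    proof -
      have "cmod c = r \<Longrightarrow> c \<noteq> 0" for c
        using that by auto
      then show ?thesis
        using that spectrum_add_annihilating[OF assms] by (auto simp: image_iff)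
    qed
    then show ?thesis by blast
  qed
  moreover have "Sup (?A \<union> ?B) = sup (Sup ?A) (Sup ?B)"
    by (intro cSup_union_distrib bdd_above_spectrum A B) auto
  ultimately show ?thesis
    by (simp add: spectral_radius_def sup_max)
qed

section \<open>Moore-Penrose inverses of selfadjoint operators\<close>

lemma selfadjoint_bounded: "selfadjoint A \<Longrightarrow> bounded_clinear A"
  by (simp add: selfadjoint_def)

lemma selfadjoint_cinner: "selfadjoint A \<Longrightarrow> cinner (A x) y = cinner x (A y)"
  by (simp add: selfadjoint_def)

lemma selfadjoint_diff: "selfadjoint A \<Longrightarrow> selfadjoint B \<Longrightarrow> selfadjoint (A - B)"
  by (simp add: selfadjoint_def bounded_clinear_diff cinner_diff_left cinner_diff_right)

lemma selfadjoint_compose_commuting: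
  assumes A: "selfadjoint A" and B: "selfadjoint B" and comm: "\<And>x. A (B x) = B (A x)"
  shows "selfadjoint (A \<circ> B)"
proof -
  have "cinner (A (B x)) y = cinner x (A (B y))" for x y
    by (simp only: selfadjoint_cinner[OF A] selfadjoint_cinner[OF B] comm)
  then show ?thesis
    using A B by (simp add: selfadjoint_def bounded_clinear_compose)
qed

text \<open>Take adjoints in \<open>A \<circ> B = 0\<close>.\<close>

lemma selfadjoint_compose_zero_commute:
  assumes A: "selfadjoint A" and B: "selfadjoint B" and AB: "\<And>x. A (B x) = 0"
  shows "B (A x) = 0"
  by (rule cinner_eqI) (simp add: selfadjoint_cinner[OF A] selfadjoint_cinner[OF B] AB)

text \<open>For any other solution \<open>Y\<close>, \<open>A \<circ> X\<close> and
  \<open>A \<circ> Y\<close> are orthogonal projections onto the range of \<open>A\<close>, hence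
  equal. Likewise \<open>X \<circ> A\<close> and \<open>Y \<circ> A\<close> are orthogonal
  projections with the nullspace of \<open>A\<close>. Then
  \<open>Y = Y A Y = X A X = X\<close>.\<close>

lemma mp_inverse_eqI:
  assumes X: "bounded_clinear X" "A \<circ> X \<circ> A = A" "X \<circ> A \<circ> X = X"
    "selfadjoint (A \<circ> X)" "selfadjoint (X \<circ> A)"
  shows "mp_inverse A = X"
  unfolding mp_inverse_def
proof (rule the_equality)
  fix Y
  assume "bounded_clinear Y \<and> A \<circ> Y \<circ> A = A \<and> Y \<circ> A \<circ> Y = Y \<and>
    selfadjoint (A \<circ> Y) \<and> selfadjoint (Y \<circ> A)"
  then have Y: "A \<circ> Y \<circ> A = A" "Y \<circ> A \<circ> Y = Y" "selfadjoint (A \<circ> Y)" "selfadjoint (Y \<circ> A)"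
    by auto
  have AX: "A (X (A x)) = A x" and XA: "X (A (X x)) = X x"
    and AY: "A (Y (A x)) = A x" and YA: "Y (A (Y x)) = Y x" for x
    using fun_cong[OF X(2)] fun_cong[OF X(3)] fun_cong[OF Y(1)] fun_cong[OF Y(2)] by simp_all
  have "cinner (A (Y x)) z = cinner (A (X x)) z" for x z
  proof -
    have "cinner (A (Y x)) z = cinner (A (X (A (Y x)))) z"
      by (simp only: AX)
    \<comment> \<open>Moving both projections to the other side reverses their order, so that
      \<open>A Y A = A\<close> absorbs \<open>Y\<close>.\<close>
    also have "\<dots> = cinner x (A (Y (A (X z))))"
      using selfadjoint_cinner[OF Y(3), of x "A (X z)"] selfadjoint_cinner[OF X(4), of "A (Y x)" z]
      by simp
    also have "\<dots> = cinner (A (X x)) z"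
      using selfadjoint_cinner[OF X(4), of x z] by (simp add: AY)
    finally show ?thesis .
  qed
  then have left: "A (Y x) = A (X x)" for x
    by (rule cinner_eqI)
  have "cinner (Y (A x)) z = cinner (X (A x)) z" for x z
  proof -
    have "cinner (Y (A x)) z = cinner (Y (A (X (A x)))) z"
      by (simp only: AX)
    also have "\<dots> = cinner x (X (A (Y (A z))))"
      using selfadjoint_cinner[OF Y(4), of "X (A x)" z] selfadjoint_cinner[OF X(5), of x "Y (A z)"]
      by simp
    also have "\<dots> = cinner (X (A x)) z"
      using selfadjoint_cinner[OF X(5), of x z] by (simp add: AY)
    finally show ?thesis .
  qed
  then have right: "Y (A x) = X (A x)" for x
    by (rule cinner_eqI)
  show "Y = X"
  proof
    fix x
    have "Y x = Y (A (Y x))"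
      by (simp only: YA)
    also have "\<dots> = X (A (X x))"
      by (simp only: left right)
    finally show "Y x = X x"
      by (simp only: XA)
  qed
qed (use X in blast)

text \<open>A selfadjoint operator commutes with its Moore-Penrose inverse, so that the four Penrose
  equations take a form symmetric in the two operators.\<close>

definition mp_pair :: "('a::chilbert_space \<Rightarrow> 'a) \<Rightarrow> ('a \<Rightarrow> 'a) \<Rightarrow> bool"
  where "mp_pair A X \<longleftrightarrow> selfadjoint A \<and> selfadjoint X \<and>
    (\<forall>x. A (X x) = X (A x)) \<and> (\<forall>x. A (X (A x)) = A x) \<and> (\<forall>x. X (A (X x)) = X x)"

lemma mp_pair_sym: "mp_pair A X \<Longrightarrow> mp_pair X A"
  unfolding mp_pair_def by auto

text \<open>Rewrite rules for a normal form: \<open>X\<close> is moved to the front of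
  \<open>A\<close>, and the other two equations are restated for words in that order.\<close>

lemma mp_pair_simps:
  assumes "mp_pair A X"
  shows "A (X x) = X (A x)" "X (X (A x)) = X x" "X (A (A x)) = A x"
proof -
  have eqs: "A (X x) = X (A x)" "A (X (A x)) = A x" "X (A (X x)) = X x" for x
    using assms unfolding mp_pair_def by blast+
  show "A (X x) = X (A x)"
    by (rule eqs)
  show "X (X (A x)) = X x"
    using eqs(3)[of x] by (simp only: eqs(1))
  show "X (A (A x)) = A x"
    using eqs(2)[of x] by (simp only: eqs(1))
qed

lemma mp_pair_bounded:
  assumes "mp_pair A X"
  shows "bounded_clinear A" "bounded_clinear X"
  using assms by (simp_all add: mp_pair_def selfadjoint_bounded)

lemma mp_pair_mp_inverse:
  assumes "mp_pair A X"
  shows "mp_inverse A = X"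
proof (rule mp_inverse_eqI)
  show "selfadjoint (A \<circ> X)" "selfadjoint (X \<circ> A)"
    using assms unfolding mp_pair_def by (blast intro: selfadjoint_compose_commuting sym)+
  show "bounded_clinear X"
    by (rule mp_pair_bounded[OF assms])
  show "A \<circ> X \<circ> A = A" "X \<circ> A \<circ> X = X"
    using assms unfolding mp_pair_def by auto
qed

text \<open>The inverse \<open>S\<close> sends \<open>x\<close> to the unique \<open>s\<close> in the range of \<open>T\<close> with \<open>T (T s) = T x\<close>.
  It is symmetric and everywhere defined, hence bounded without the open mapping theorem.\<close>

lemma mp_pair_exists:
  assumes T: "selfadjoint T" and cl: "closed (range T)"
  shows "\<exists>X. mp_pair T X"
proof -
  note sa = selfadjoint_cinner[OF T]
  note lin = bounded_clinear_linear[OF selfadjoint_bounded[OF T]]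
  have ker: "T x = 0" if "T (T x) = 0" for x
  proof -
    have "cinner (T x) (T x) = 0"
      by (simp add: sa that)
    then show ?thesis
      using Re_cinner[of "T x" "T x"] by simp
  qed
  have sub: "subspace (range T)"
    using selfadjoint_bounded[OF T]
    by (intro linear_subspace_image) (auto simp: bounded_clinear_def bounded_linear.linear)
  have preimage: "\<exists>u. T (T u) = T x" for x
  proof -
    obtain m where m: "m \<in> range T" "\<And>y. y \<in> range T \<Longrightarrow> inner (x - m) y = 0"
      using closed_subspace_orthogonal_split[OF sub cl] by metis
    \<comment> \<open>The residual \<open>x - m\<close> is orthogonal to \<open>range T\<close>,
      hence lies in the nullspace of \<open>T\<close>. So \<open>T x = T m\<close> with
      \<open>m\<close> in \<open>range T\<close>.\<close>
    have "inner (T (x - m)) (T (x - m)) = inner (x - m) (T (T (x - m)))"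
      by (simp only: Re_cinner[symmetric] sa)
    then have "T (x - m) = 0"
      using m(2) by simp
    then show ?thesis
      using m(1) by (auto simp: lin)
  qed
  have uniq: "s = t" if st: "s \<in> range T" "t \<in> range T" "T (T s) = T (T t)" for s t
  proof -
    obtain u v where uv: "s = T u" "t = T v"
      using st(1,2) by blast
    have "T (T (T (u - v))) = 0"
      using st(3) by (simp add: uv lin)
    then have "T (u - v) = 0"
      using ker by blast
    then show ?thesis
      by (simp add: uv lin)
  qed
  \<comment> \<open>A second use of \<open>preimage\<close> replaces \<open>u\<close> by
    \<open>T v\<close>, which puts the solution inside \<open>range T\<close>.\<close>
  have "\<exists>s\<in>range T. T (T s) = T x" for x
  proof -
    obtain u where "T (T u) = T x"
      using preimage by blast
    moreover obtain v where "T (T v) = T u"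
      using preimage by blast
    ultimately have "T (T (T v)) = T x"
      by simp
    then show ?thesis
      by blast
  qed
  then obtain S where S: "\<And>x. S x \<in> range T" "\<And>x. T (T (S x)) = T x"
    by metis
  \<comment> \<open>This characterization of \<open>S x\<close> yields linearity and the Penrose
    identities by checking candidates.\<close>
  have S_eq: "S x = s" if "s \<in> range T" "T (T s) = T x" for s x
    using uniq[OF S(1) that(1)] S(2) that(2) by simp
  have range_add: "s + t \<in> range T" if "s \<in> range T" "t \<in> range T" for s t
    using subspace_add[OF sub that] .
  have range_scaleC: "c *\<^sub>C s \<in> range T" if "s \<in> range T" for c s
    using that by (auto simp: lin(5)[symmetric])
  have S_add: "S (x + y) = S x + S y" for x y
    by (rule S_eq) (auto simp: S lin range_add)
  have S_scaleC: "S (c *\<^sub>C x) = c *\<^sub>C S x" for c x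
    by (rule S_eq) (auto simp: S lin range_scaleC)
  have ST: "S (T x) = T (S x)" for x
    by (rule S_eq) (auto simp: S lin)
  have TST: "T (S (T x)) = T x" for x
    by (simp add: ST S)
  have TSS: "T (S (S x)) = S x" for x
    by (rule S_eq[symmetric]) (auto simp: S)
  have STS: "S (T (S x)) = S x" for x
    by (rule S_eq) (auto simp: S)
  have sym: "cinner (S x) y = cinner x (S y)" for x y
  proof -
    \<comment> \<open>Writing \<open>S x\<close> as \<open>T (S (S x))\<close> supplies a factor
      \<open>T\<close> to move across. Repeating this with \<open>T (T (S x)) = T x\<close>
      transfers \<open>S\<close> to the second argument.\<close>
    have "cinner (S x) y = cinner (S (S x)) (T y)"
      by (subst TSS[symmetric]) (rule sa)
    also have "\<dots> = cinner (T (S (S x))) (T (S y))"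
      by (simp only: S(2)[of y, symmetric] sa)
    also have "\<dots> = cinner (T (S x)) (T (S (S y)))"
      by (simp only: TSS sa)
    also have "\<dots> = cinner (T (T (S x))) (S (S y))"
      by (simp only: sa)
    also have "\<dots> = cinner x (T (S (S y)))"
      by (simp only: S sa)
    also have "\<dots> = cinner x (S y)"
      by (simp only: TSS)
    finally show ?thesis .
  qed
  have "bounded_linear S"
  proof (rule Hellinger_Toeplitz)
    show "linear S"
      by (rule linearI) (auto simp: S_add scaleR_scaleC S_scaleC)
    show "inner (S x) y = inner x (S y)" for x y
      by (simp add: Re_cinner[symmetric] sym)
  qed
  then have "selfadjoint S"
    by (simp add: selfadjoint_def bounded_clinear_def S_scaleC sym)
  then have "mp_pair T S"
    unfolding mp_pair_def using T ST TST STS by simp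
  then show ?thesis
    by blast
qed

section \<open>Differences of annihilating pairs, and proper splittings\<close>

text \<open>Since \<open>X = X X A\<close>, the nullspace of \<open>A\<close> is contained in that
  of \<open>X\<close>.\<close>

lemma mp_pair_annihilates_right:
  assumes A: "mp_pair A X" and B: "bounded_clinear B" and AB: "\<And>x. A (B x) = 0"
  shows "X (B x) = 0"
proof -
  have "X (B x) = X (X (A (B x)))"
    by (simp only: mp_pair_simps(2)[OF A])
  also have "\<dots> = 0"
    by (simp only: AB bounded_clinear_linear(3)[OF mp_pair_bounded(2)[OF A]])
  finally show ?thesis .
qed

text \<open>Passing from \<open>A1\<close> or \<open>A2\<close> to its inverse and taking adjoints,
  in alternation, makes all eight mixed products vanish. The equations for the differences then
  split into those of the two pairs.\<close>

lemma mp_pair_diff: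
  assumes 1: "mp_pair A1 X1" and 2: "mp_pair A2 X2" and A12: "\<And>x. A1 (A2 x) = 0"
  shows "mp_pair (A1 - A2) (X1 - X2)"
proof -
  have sa: "selfadjoint A1" "selfadjoint X1" "selfadjoint A2" "selfadjoint X2"
    using 1 2 by (auto simp: mp_pair_def)
  note bc = sa[THEN selfadjoint_bounded]
  note lin = bc[THEN bounded_clinear_linear(1)] bc[THEN bounded_clinear_linear(2)]
    bc[THEN bounded_clinear_linear(3)]
  have A21: "A2 (A1 x) = 0" for x
    by (rule selfadjoint_compose_zero_commute[OF sa(1,3) A12])
  have X1A2: "X1 (A2 x) = 0" for x
    by (rule mp_pair_annihilates_right[OF 1 bc(3) A12])
  have X2A1: "X2 (A1 x) = 0" for x
    by (rule mp_pair_annihilates_right[OF 2 bc(1) A21])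
  have A1X2: "A1 (X2 x) = 0" for x
    by (rule selfadjoint_compose_zero_commute[OF sa(4,1) X2A1])
  have A2X1: "A2 (X1 x) = 0" for x
    by (rule selfadjoint_compose_zero_commute[OF sa(2,3) X1A2])
  have X12: "X1 (X2 x) = 0" for x
    by (rule mp_pair_annihilates_right[OF 1 bc(4) A1X2])
  have X21: "X2 (X1 x) = 0" for x
    by (rule mp_pair_annihilates_right[OF 2 bc(2) A2X1])
  show ?thesis
    by (simp add: mp_pair_def selfadjoint_diff sa lin mp_pair_simps[OF 1] mp_pair_simps[OF 2]
        A12 A21 X1A2 X2A1 A1X2 A2X1 X12 X21)
qed

text \<open>\<open>A X\<close> and \<open>B Y\<close> are the orthogonal projections onto the ranges
  of \<open>A\<close> and \<open>B\<close>, so their equality gives equal ranges. By commutation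
  also \<open>X A = Y B\<close>, which gives equal nullspaces.\<close>

lemma mp_pair_proper_splitting:
  assumes AX: "mp_pair A X" and BY: "mp_pair B Y" and proj: "\<And>x. A (X x) = B (Y x)"
  shows "proper_splitting A B (B - A)"
proof -
  note bc = mp_pair_bounded[OF AX] mp_pair_bounded[OF BY]
  note zero = bc(2,4)[THEN bounded_clinear_linear(3)]
  have A: "B (Y (A x)) = A x" for x
    by (simp only: proj[symmetric] mp_pair_simps[OF AX])
  have B: "A (X (B x)) = B x" for x
    by (simp only: proj mp_pair_simps[OF BY])
  have "A x \<in> range B" "B x \<in> range A" for x
    by (metis A rangeI) (metis B rangeI)
  then have "range B = range A"
    by blast
  moreover have "B x = 0 \<longleftrightarrow> A x = 0" for x
  proof
    have XY: "X (A x) = Y (B x)"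
      using proj[of x] by (simp only: mp_pair_simps[OF AX] mp_pair_simps[OF BY])
    show "A x = 0" if "B x = 0"
    proof -
      have "A x = A (X (A x))"
        by (simp only: mp_pair_simps[OF AX])
      also have "\<dots> = 0"
        by (simp only: XY that zero bc(1)[THEN bounded_clinear_linear(3)])
      finally show ?thesis .
    qed
    show "B x = 0" if "A x = 0"
    proof -
      have "B x = B (Y (B x))"
        by (simp only: mp_pair_simps[OF BY])
      also have "\<dots> = 0"
        by (simp only: XY[symmetric] that zero bc(3)[THEN bounded_clinear_linear(3)])
      finally show ?thesis .
    qed
  qed
  ultimately show ?thesis
    using bc by (auto simp: proper_splitting_def nullspace_def bounded_clinear_diff)
qed

section \<open>Positive orthogonal decompositions\<close>

lemma pos_orth_decomposition_annihilates:
  assumes "pos_orth_decomposition T T1 T2"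
  shows "T1 (T2 x) = 0"
proof (rule cinner_eqI)
  fix z
  have sa: "selfadjoint T1"
    using assms by (simp add: pos_orth_decomposition_def positive_op_def)
  have "cinner (T1 z) (T2 x) = 0"
    using assms closure_subset[THEN subsetD, OF rangeI, of T1]
      closure_subset[THEN subsetD, OF rangeI, of T2]
    unfolding pos_orth_decomposition_def by simp
  then have "cinner (T2 x) (T1 z) = 0"
    using cinner_commute[of "T2 x" "T1 z"] by simp
  then show "cinner (T1 (T2 x)) z = cinner 0 z"
    by (simp add: selfadjoint_cinner[OF sa])
qed

text \<open>A point \<open>y\<close> of \<open>closure (range T1)\<close> lies in
  \<open>range T\<close>, so \<open>y = T1 x - T2 x\<close>. Then \<open>T2 x = T1 x - y\<close> is
  orthogonal to itself and vanishes, leaving \<open>y = T1 x\<close>. For \<open>T2\<close> the same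
  argument gives \<open>y = T2 (- x)\<close>.\<close>

lemma pos_orth_decomposition_closed_range:
  assumes D: "pos_orth_decomposition T T1 T2" and cl: "closed (range T)"
  shows "closed (range T1)" "closed (range T2)"
proof -
  have T: "T x = T1 x - T2 x" for x
    using D by (simp add: pos_orth_decomposition_def)
  have sum: "{x + y |x y. x \<in> closure (range T1) \<and> y \<in> closure (range T2)} = range T"
    using D cl by (simp add: pos_orth_decomposition_def)
  have orth: "inner x y = 0" if "x \<in> closure (range T1)" "y \<in> closure (range T2)" for x y
    using D that Re_cinner[of x y] by (simp add: pos_orth_decomposition_def)
  have bc: "bounded_clinear T1" "bounded_clinear T2"
    using D by (simp_all add: pos_orth_decomposition_def positive_op_def selfadjoint_def)
  have cl1: "T1 x \<in> closure (range T1)" and cl2: "T2 x \<in> closure (range T2)" for x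
    by (rule closure_subset[THEN subsetD, OF rangeI])+
  have zero: "0 \<in> closure (range T1)" "0 \<in> closure (range T2)"
    using cl1[of 0] cl2[of 0] bc by (simp_all add: bounded_clinear_linear)
  have "y \<in> range T1" if y: "y \<in> closure (range T1)" for y
  proof -
    have "y + 0 \<in> range T"
      using y zero unfolding sum[symmetric] by blast
    then obtain x where x: "y = T1 x - T2 x"
      by (auto simp: T)
    have "inner (T1 x - y) (T2 x) = 0"
      using orth[OF cl1 cl2] orth[OF y cl2] by (simp add: inner_diff_left)
    then have "T2 x = 0"
      by (simp add: x)
    then show ?thesis by (simp add: x)
  qed
  then show "closed (range T1)"
    by (simp add: closure_subset_eq[symmetric] subsetI)
  have "y \<in> range T2" if y: "y \<in> closure (range T2)" for y
  proof -
    have "0 + y \<in> range T"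
      using y zero unfolding sum[symmetric] by blast
    then obtain x where x: "y = T1 x - T2 x"
      by (auto simp: T)
    have "inner (T1 x) (y + T2 x) = 0"
      using orth[OF cl1 cl2] orth[OF cl1 y] by (simp add: inner_add_right)
    then have "T1 x = 0"
      by (simp add: x)
    then have "y = T2 (- x)"
      by (simp add: x bounded_clinear_linear[OF bc(2)])
    then show ?thesis by blast
  qed
  then show "closed (range T2)"
    by (simp add: closure_subset_eq[symmetric] subsetI)
qed

section \<open>Comparison of the three splittings\<close>

theorem corollary4p16:
  fixes T T1 T2 V W Z :: "'a::chilbert_space \<Rightarrow> 'a"
  assumes "selfadjoint T"
    and "closed (range T)"
    and "pos_orth_decomposition T T1 T2"
    and "V = mp_inverse T - T"
    and "W = mp_inverse T1 - T2 - T"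
    and "Z = T1 - mp_inverse T2 - T"
  shows "proper_splitting T (mp_inverse T) V \<and>
    proper_splitting T (mp_inverse T1 - T2) W \<and>
    proper_splitting T (T1 - mp_inverse T2) Z \<and>
    (splitting_converges (mp_inverse T) V \<longleftrightarrow>
      splitting_converges (mp_inverse T1 - T2) W \<and>
      splitting_converges (T1 - mp_inverse T2) Z) \<and>
    (splitting_converges (mp_inverse T) V \<longrightarrow>
      max (spectral_radius (mp_inverse (mp_inverse T1 - T2) \<circ> W))
          (spectral_radius (mp_inverse (T1 - mp_inverse T2) \<circ> Z))
        = spectral_radius (T \<circ> V))"
proof -
  note D = assms(3)
  have sa: "selfadjoint T1" "selfadjoint T2" and T: "T = T1 - T2"
    using D by (auto simp: pos_orth_decomposition_def positive_op_def)
  obtain X1 X2 where 1: "mp_pair T1 X1" and 2: "mp_pair T2 X2"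
    using mp_pair_exists sa pos_orth_decomposition_closed_range[OF D assms(2)] by metis
  note bc = selfadjoint_bounded[OF sa(1)] selfadjoint_bounded[OF sa(2)]
  have bcX: "bounded_clinear X1" "bounded_clinear X2" and saX: "selfadjoint X1" "selfadjoint X2"
    using 1 2 by (auto simp: mp_pair_def selfadjoint_bounded)
  note lin = bounded_clinear_linear[OF bc(1)] bounded_clinear_linear[OF bc(2)]
    bounded_clinear_linear[OF bcX(1)] bounded_clinear_linear[OF bcX(2)]
  have T12: "T1 (T2 x) = 0" for x
    by (rule pos_orth_decomposition_annihilates[OF D])
  have T21: "T2 (T1 x) = 0" for x
    by (rule selfadjoint_compose_zero_commute[OF sa T12])
  have X1T2: "X1 (T2 x) = 0" for x
    by (rule mp_pair_annihilates_right[OF 1 bc(2) T12])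
  have X2T1: "X2 (T1 x) = 0" for x
    by (rule mp_pair_annihilates_right[OF 2 bc(1) T21])
  have T1X2: "T1 (X2 x) = 0" for x
    by (rule selfadjoint_compose_zero_commute[OF saX(2) sa(1) X2T1])
  have T2X1: "T2 (X1 x) = 0" for x
    by (rule selfadjoint_compose_zero_commute[OF saX(1) sa(2) X1T2])
  have X12: "X1 (X2 x) = 0" for x
    by (rule mp_pair_annihilates_right[OF 1 bcX(2) T1X2])
  have X21: "X2 (X1 x) = 0" for x
    by (rule selfadjoint_compose_zero_commute[OF saX X12])
  note annih = T12 T21 X1T2 X2T1 T1X2 T2X1 X12 X21
  have TX: "mp_pair T (X1 - X2)"
    unfolding T by (rule mp_pair_diff[OF 1 2 T12])
  \<comment> \<open>Swapping the first pair lets the difference lemma act on \<open>X1\<close> and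
    \<open>T2\<close>, which annihilate each other too.\<close>
  have U1: "mp_pair (X1 - T2) (T1 - X2)"
    by (rule mp_pair_diff[OF mp_pair_sym[OF 1] 2 X1T2])
  have comm: "X1 (T1 x) = T1 (X1 x)" "X2 (T2 x) = T2 (X2 x)" for x
    using 1 2 by (auto simp: mp_pair_def)
  have mp: "mp_inverse T1 = X1" "mp_inverse T2 = X2" "mp_inverse T = X1 - X2"
    "mp_inverse (X1 - X2) = T"
    "mp_inverse (X1 - T2) = T1 - X2" "mp_inverse (T1 - X2) = X1 - T2"
    using mp_pair_mp_inverse 1 2 TX U1 mp_pair_sym by metis+
  have V: "V = (X1 - X2) - T" and W: "W = (X1 - T2) - T" and Z: "Z = (T1 - X2) - T"
    using assms(4-6) mp by simp_all
  \<comment> \<open>In each case the range projection is \<open>T1 X1 + T2 X2\<close>, the same as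
    for \<open>T\<close>.\<close>
  have split: "proper_splitting T (X1 - X2) V" "proper_splitting T (X1 - T2) W"
    "proper_splitting T (T1 - X2) Z"
    unfolding V W Z
    by (rule mp_pair_proper_splitting[OF TX mp_pair_sym[OF TX]]
        mp_pair_proper_splitting[OF TX U1] mp_pair_proper_splitting[OF TX mp_pair_sym[OF U1]];
      simp add: T lin annih comm)+
  define A B where "A = (T1 \<circ> X1) - (T1 \<circ> T1)" and "B = (T2 \<circ> X2) - (T2 \<circ> T2)"
  have bcAB: "bounded_clinear A" "bounded_clinear B"
    unfolding A_def B_def by (intro bounded_clinear_diff bounded_clinear_compose bc bcX)+
  \<comment> \<open>Cancelling against \<open>T = T1 - T2\<close> leaves \<open>W = X1 - T1\<close>
    and \<open>Z = T2 - X2\<close>, and the mixed products drop out.\<close>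
  have AW: "(T1 - X2) \<circ> W = A" and BZ: "(X1 - T2) \<circ> Z = B" and TV: "T \<circ> V = (\<lambda>x. A x + B x)"
    by (simp_all add: fun_eq_iff V W Z T A_def B_def lin annih comm)
  have "spectral_radius (T \<circ> V) = max (spectral_radius A) (spectral_radius B)"
    unfolding TV
    by (rule spectral_radius_add_annihilating[OF bcAB]) (simp_all add: A_def B_def lin annih)
  \<comment> \<open>As \<open>T\<close> is the Moore-Penrose inverse of \<open>X1 - X2\<close>, the
    first iteration operator is \<open>T \<circ> V\<close>. The equivalence says that a maximum is
    below 1 exactly when both entries are.\<close>
  then show ?thesis
    using split by (simp add: splitting_converges_def mp AW BZ)
qed

end
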